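(* Let $n \ge 1$ and $\ell \ge 2$ be integers, and let $x=(x_1,\dots,x_n)\in\mathbb{Z}^n$ satisfy $x_1\le\dots\le x_n$ and have at least one entry that is a multiple of $\ell$. Let $x'$ be obtained from $x$ by a finite sequence of successive GM-moves. Then: (i) if $\mathrm{range}(x)\le \ell$, then $\mathrm{range}(x')\le\ell$; (ii) $\mathrm{range}(x')-\mathrm{range}(x)\le \ell$.
   Context: Notation: $[n]=\{1,\dots,n\}$. Entries of vectors are integers and may be negative; $0$ and negative multiples count as multiples of $\ell$. For a vector with $x_1\le\dots\le x_n$, $\mathrm{range}(x)=x_n-x_1$. Pivot: let $x=(x_1,\dots,x_n)$ be an integer vector with $x_1\le \dots\le x_n$ having at least one entry that is a multiple of $\ell$. Among the entries of $x$ that are multiples of $\ell$, take the minimal value; the pivot of $x$, $\mathrm{pivot}(x)\in[n]$, is the largest index $i$ such that $x_i$ equals this value. GM-move: the GM-move $x\to x'$ keeps the pivotal entry ($x'_i=x_i$ for $i=\mathrm{pivot}(x)$) and reduces each of the other $n-1$ entries by $1$ ($x'_k=x_k-1$ for $k\ne i$). The vector $x'$ again satisfies $x'_1\le\dots\le x'_n$ and has an entry that is a multiple of $\ell$, so GM-moves can be iterated. *)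

theory Defs
  imports Main
begin

text \<open>An integer vector \<open>(x\<^sub>1, \<dots>, x\<^sub>n)\<close> is a function \<open>x :: nat \<Rightarrow> int\<close> of which
  only the values at the indices \<open>1, \<dots>, n\<close> matter.\<close>

definition vrange :: "nat \<Rightarrow> (nat \<Rightarrow> int) \<Rightarrow> int" where
  "vrange n x = x n - x 1"

text \<open>\<open>Min\<close> and \<open>Max\<close> are meaningful here only if some entry is a multiple of \<open>l\<close>;
  otherwise the pivot is unspecified.\<close>

definition pivot :: "nat \<Rightarrow> int \<Rightarrow> (nat \<Rightarrow> int) \<Rightarrow> nat" where
  "pivot n l x = Max {i \<in> {1..n}. x i = Min {x j | j. j \<in> {1..n} \<and> l dvd x j}}"

definition gm_move :: "nat \<Rightarrow> int \<Rightarrow> (nat \<Rightarrow> int) \<Rightarrow> (nat \<Rightarrow> int)" where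
  "gm_move n l x = (\<lambda>k. if k \<in> {1..n} \<and> k \<noteq> pivot n l x then x k - 1 else x k)"

end

theory Submission
  imports Defs
begin

text \<open>The range grows only in a move whose pivot is the last entry, and then by \<open>1\<close>. Call \<open>x\<close>
  narrow if some multiple of \<open>l\<close> among the entries is less than \<open>x\<^sub>1 + l\<close>. Narrowness persists: if
  \<open>x\<^sub>1\<close> falls to \<open>l\<close> below the pivotal value, it becomes a multiple of \<open>l\<close> itself. If \<open>x\<close> is narrow
  with last entry pivotal, its range is less than \<open>l\<close>, so from a narrow vector on the range never
  exceeds the maximum of its value and \<open>l\<close>; this gives (i), as range at most \<open>l\<close> implies narrow.
  Until the vector is narrow, every move decreases \<open>x\<^sub>1 mod l\<close> by \<open>1\<close>, which bounds the number of
  such moves by \<open>l - 1\<close>; this gives (ii).\<close>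

definition narrow :: "nat \<Rightarrow> int \<Rightarrow> (nat \<Rightarrow> int) \<Rightarrow> bool" where
  "narrow n l x \<longleftrightarrow> (\<exists>j\<in>{1..n}. l dvd x j \<and> x j < x 1 + l)"

context
  fixes n :: nat and l :: int and x :: "nat \<Rightarrow> int"
  assumes mult: "\<exists>i\<in>{1..n}. l dvd x i"
begin

lemma pivot_mem_Min:
  "pivot n l x \<in> {i \<in> {1..n}. x i = Min {x j | j. j \<in> {1..n} \<and> l dvd x j}}"
proof -
  let ?V = "{x j | j. j \<in> {1..n} \<and> l dvd x j}"
  have "Min ?V \<in> ?V"
    using mult by (intro Min_in) auto
  then have "{i \<in> {1..n}. x i = Min ?V} \<noteq> {}"
    by auto
  then show ?thesis
    unfolding pivot_def by (intro Max_in) auto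
qed

lemma pivot_in: "pivot n l x \<in> {1..n}"
  using pivot_mem_Min by simp

lemma dvd_pivot: "l dvd x (pivot n l x)"
proof -
  let ?V = "{x j | j. j \<in> {1..n} \<and> l dvd x j}"
  have "Min ?V \<in> ?V"
    using mult by (intro Min_in) auto
  then show ?thesis
    using pivot_mem_Min by auto
qed

lemma pivot_le: "j \<in> {1..n} \<Longrightarrow> l dvd x j \<Longrightarrow> x (pivot n l x) \<le> x j"
  using pivot_mem_Min by (auto intro: Min_le)

lemma narrow_pivot:
  assumes "narrow n l x"
  shows "x (pivot n l x) < x 1 + l"
proof -
  obtain j where "j \<in> {1..n}" "l dvd x j" "x j < x 1 + l"
    using assms unfolding narrow_def by blast
  then show ?thesis
    using pivot_le[of j] by linarith
qed

lemma gm_move_pivot: "gm_move n l x (pivot n l x) = x (pivot n l x)"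
  by (simp add: gm_move_def)

lemma gm_move_dvd: "\<exists>i\<in>{1..n}. l dvd gm_move n l x i"
  using pivot_in dvd_pivot gm_move_pivot by metis

text \<open>The last entry never rises and the first falls by at most 1.\<close>

lemma vrange_gm_move_le: "vrange n (gm_move n l x) \<le> vrange n x + 1"
  by (auto simp: vrange_def gm_move_def)

lemma vrange_gm_move_le_max:
  assumes "narrow n l x"
  shows "vrange n (gm_move n l x) \<le> max l (vrange n x)"
proof (cases "pivot n l x = n")
  case True
  then have "vrange n x < l"
    using narrow_pivot[OF assms] by (simp add: vrange_def)
  then show ?thesis
    using vrange_gm_move_le by linarith
next
  case False
  \<comment> \<open>Here the last entry falls by 1 and the first by at most 1.\<close>
  then show ?thesis
    using pivot_in by (auto simp: gm_move_def vrange_def)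
qed

lemma narrow_gm_move:
  assumes l: "0 < l" and "narrow n l x"
  shows "narrow n l (gm_move n l x)"
proof -
  let ?y = "gm_move n l x" and ?p = "pivot n l x"
  have p: "x ?p < x 1 + l"
    using narrow_pivot assms(2) by blast
  have n: "1 \<in> {1..n}"
    using pivot_in by auto
  show ?thesis
  proof (cases "x ?p < ?y 1 + l")
    case True
    then show ?thesis
      using pivot_in dvd_pivot gm_move_pivot unfolding narrow_def by metis
  next
    case False
    \<comment> \<open>The first entry falls by at most 1, so over the integers \<open>p\<close>
      leaves only equality.\<close>
    then have "?y 1 = x ?p - l"
      using p by (auto simp: gm_move_def split: if_splits)
    then have "l dvd ?y 1"
      using dvd_pivot by simp
    then show ?thesis
      using n l unfolding narrow_def by (intro bexI[of _ 1]) auto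
  qed
qed

end

lemma narrow_if_dvd_first: "1 \<le> n \<Longrightarrow> 0 < l \<Longrightarrow> l dvd x 1 \<Longrightarrow> narrow n l x"
  unfolding narrow_def by (intro bexI[of _ 1]) auto

text \<open>By sortedness every multiple of \<open>l\<close> among the entries is at most
  \<open>x n\<close>, hence at most \<open>x 1 + l\<close>; at equality \<open>x 1\<close> itself is
  a multiple and serves as witness.\<close>

lemma narrow_if_vrange_le:
  assumes "1 \<le> n" "0 < l" "mono_on {1..n} x" "\<exists>i\<in>{1..n}. l dvd x i" "vrange n x \<le> l"
  shows "narrow n l x"
proof -
  obtain i where i: "i \<in> {1..n}" "l dvd x i"
    using assms(4) by blast
  have "x i \<le> x n"
    using mono_onD[OF assms(3) i(1), of n] i(1) by simp
  then have le: "x i \<le> x 1 + l"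
    using assms(5) by (simp add: vrange_def)
  show ?thesis
  proof (cases "x i = x 1 + l")
    case True
    then have "l dvd x 1"
      using i(2) by simp
    then show ?thesis
      using assms(1,2) narrow_if_dvd_first by blast
  next
    case False
    then show ?thesis
      using i le unfolding narrow_def by (intro bexI[of _ i]) auto
  qed
qed

lemma gm_moves_dvd:
  assumes "\<exists>i\<in>{1..n}. l dvd x i"
  shows "\<exists>i\<in>{1..n}. l dvd (gm_move n l ^^ m) x i"
  by (induction m) (use assms gm_move_dvd in auto)

text \<open>Narrowness is carried through the induction because the range bound for a single move
  requires it.\<close>

lemma gm_moves_narrow:
  assumes "0 < l" "\<exists>i\<in>{1..n}. l dvd x i" "narrow n l x"
  shows "narrow n l ((gm_move n l ^^ m) x) \<and> vrange n ((gm_move n l ^^ m) x) \<le> max l (vrange n x)"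
proof (induction m)
  case (Suc m)
  have dvd: "\<exists>i\<in>{1..n}. l dvd (gm_move n l ^^ m) x i"
    using gm_moves_dvd[OF assms(2)] .
  show ?case
    using Suc narrow_gm_move[OF dvd assms(1)] vrange_gm_move_le_max[OF dvd] by fastforce
qed (simp add: assms)

text \<open>Range plus residue of the first entry is a potential: in a move from a non-narrow vector
  the range gains at most 1 and the residue loses 1. Initially the strict bound is
  \<open>x 1 mod l < l\<close>.\<close>

lemma gm_moves_vrange:
  assumes "1 \<le> n" "0 < l" "mono_on {1..n} x" "\<exists>i\<in>{1..n}. l dvd x i"
  defines "y \<equiv> \<lambda>m. (gm_move n l ^^ m) x"
  shows "vrange n (y m) \<le> vrange n x + l \<and>
    (narrow n l (y m) \<or> vrange n (y m) + y m 1 mod l < vrange n x + l)"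
proof (induction m)
  case 0
  then show ?case
    using assms by simp
next
  case (Suc m)
  have dvd: "\<exists>i\<in>{1..n}. l dvd y m i"
    using gm_moves_dvd[OF assms(4)] unfolding y_def .
  have y: "y (Suc m) = gm_move n l (y m)"
    by (simp add: y_def)
  \<comment> \<open>Nonnegativity gives \<open>l \<le> vrange n x + l\<close>, which keeps the
    maximum in the narrow case within the bound.\<close>
  have "x 1 \<le> x n"
    using mono_onD[OF assms(3), of 1 n] assms(1) by simp
  then have nonneg: "0 \<le> vrange n x"
    by (simp add: vrange_def)
  show ?case
  proof (cases "narrow n l (y m)")
    case True
    then show ?thesis
      using Suc nonneg narrow_gm_move[OF dvd assms(2)] vrange_gm_move_le_max[OF dvd] y
        assms(2) by simp
  next
    case False
    \<comment> \<open>So the first entry is not pivotal, and its residue is positive: subtracting 1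
      does not wrap around modulo \<open>l\<close>.\<close>
    then have nd: "\<not> l dvd y m 1"
      using assms(1,2) narrow_if_dvd_first by blast
    then have "pivot n l (y m) \<noteq> 1"
      using dvd_pivot[OF dvd] by metis
    then have y1: "y (Suc m) 1 = y m 1 - 1"
      using assms(1) y by (simp add: gm_move_def)
    have "y m 1 mod l < l"
      using assms(2) by simp
    moreover have pos: "0 < y m 1 mod l"
      using nd assms(2) pos_mod_sign[of l "y m 1"] by (simp add: dvd_eq_mod_eq_0 order_less_le)
    ultimately have "(y m 1 mod l - 1) mod l = y m 1 mod l - 1"
      by (intro mod_pos_pos_trivial) auto
    then have "y (Suc m) 1 mod l = y m 1 mod l - 1"
      using y1 by (simp add: mod_diff_left_eq)
    then show ?thesis
      using Suc False y vrange_gm_move_le[OF dvd] pos by auto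
  qed
qed

theorem lemma1:
  fixes n :: nat and l :: int and x x' :: "nat \<Rightarrow> int"
  assumes "n \<ge> 1" and "l \<ge> 2"
    and "mono_on {1..n} x"
    and "\<exists>i\<in>{1..n}. l dvd x i"
    and "\<exists>m. x' = (gm_move n l ^^ m) x"
  shows "(vrange n x \<le> l \<longrightarrow> vrange n x' \<le> l) \<and> vrange n x' - vrange n x \<le> l"
proof -
  obtain m where x': "x' = (gm_move n l ^^ m) x"
    using assms(5) by blast
  have l: "0 < l"
    using assms(2) by simp
  have "vrange n x' \<le> l" if "vrange n x \<le> l"
    using gm_moves_narrow[OF l assms(4) narrow_if_vrange_le[OF assms(1) l assms(3,4) that], of m]
      that x' by simp
  moreover have "vrange n x' \<le> vrange n x + l"
    using gm_moves_vrange[OF assms(1) l assms(3,4)] x' by blast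
  ultimately show ?thesis
    by simp
qed

end
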